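(* For every $d\in\mathbb{N}$ with $d\ge4$ and every $P\in\mathcal{P}(\{0,1\}^d)$, one has $$\operatorname{xc}(P)\le9\,\frac{2^d}{d}.$$
   Context: $\mathcal{P}(\{0,1\}^d)=\{\operatorname{conv}(X'):X'\subseteq\{0,1\}^d\}$ is the set of all $0/1$-polytopes in $\mathbb{R}^d$. A polytope $P\subseteq\mathbb{R}^d$ has an extended formulation with $\ell$ linear inequalities if there exist $n\in\mathbb{N}=\{1,2,3,\ldots\}$, an affine map $\varphi:\mathbb{R}^n\to\mathbb{R}^d$ and affine functions $M_1,\ldots,M_\ell:\mathbb{R}^n\to\mathbb{R}$ such that $P=\varphi(Q)$ with $Q=\{x\in\mathbb{R}^n:M_1(x)\ge0,\ldots,M_\ell(x)\ge0\}$. The linear extension complexity $\operatorname{xc}(P)$ is the smallest $\ell$ such that $P$ has an extended formulation with $\ell$ linear inequalities; if $P$ is empty or a single point, $\operatorname{xc}(P)=0$. *)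

theory Defs
  imports "HOL-Analysis.Analysis"
begin

text \<open>
  The dimension of the lifted space is existentially quantified in the definition of an extended
  formulation, so it cannot be a type. The space of real vectors with \<open>n\<close> coordinates is therefore
  represented by the functions on \<open>{..<n}\<close>, extended by \<open>undefined\<close>; this makes a vector and its
  coordinates correspond uniquely.
\<close>

definition vecs :: "nat \<Rightarrow> (nat \<Rightarrow> real) set" where
  "vecs n = {..<n} \<rightarrow>\<^sub>E UNIV"

text \<open>Taking \<^typ>\<open>real\<close> as codomain gives the affine functions.\<close>

definition affine_map :: "nat \<Rightarrow> ((nat \<Rightarrow> real) \<Rightarrow> 'a::real_vector) \<Rightarrow> bool" where
  "affine_map n f \<longleftrightarrow> (\<exists>c a. \<forall>x\<in>vecs n. f x = c + (\<Sum>j<n. x j *\<^sub>R a j))"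

definition has_extended_formulation :: "'a::real_vector set \<Rightarrow> nat \<Rightarrow> bool" where
  "has_extended_formulation P l \<longleftrightarrow>
     (\<exists>n\<ge>1. \<exists>(\<phi> :: (nat \<Rightarrow> real) \<Rightarrow> 'a) (M :: nat \<Rightarrow> (nat \<Rightarrow> real) \<Rightarrow> real).
        affine_map n \<phi> \<and> (\<forall>k<l. affine_map n (M k)) \<and>
        P = \<phi> ` {x \<in> vecs n. \<forall>k<l. M k x \<ge> 0})"

text \<open>
  Every polytope has an extended formulation, so \<open>LEAST\<close> is a genuine minimum there. The empty set
  needs one inequality, hence its value 0 is a convention; for a single point the minimum is
  already 0.
\<close>

definition xc :: "'a::real_vector set \<Rightarrow> nat" where
  "xc P = (if P = {} \<or> (\<exists>p. P = {p}) then 0 else (LEAST l. has_extended_formulation P l))"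

definition zero_one_points :: "(real ^ 'd) set" where
  "zero_one_points = {x. \<forall>i. x $ i \<in> {0, 1}}"

definition zero_one_polytopes :: "(real ^ 'd) set set" where
  "zero_one_polytopes = {convex hull X | X. X \<subseteq> zero_one_points}"

end

theory Submission
  imports Defs
begin

text \<open>
  Split the \<open>d\<close> coordinates into \<open>m\<close> inner and \<open>d - m\<close> outer ones, where \<open>2 ^ m\<close> lies between
  \<open>d / 4\<close> and \<open>d / 2\<close>. The inner slices of \<open>X\<close> take at most \<open>2 ^ 2 ^ m\<close> different values \<open>Y\<close>, and
  grouping the outer points \<open>a\<close> by their slice \<open>F a\<close> exhibits \<open>X\<close> as a union of products
  \<open>F -` {Y} \<times> Y\<close>. The convex hull of such a union is described by weights on the outer points and,
  for each \<open>Y\<close>, weights on \<open>Y\<close> with the same total mass as the outer points with slice \<open>Y\<close>.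
  The dominating term in the number of inequalities is the number \<open>2 ^ (d - m) < 4 * 2 ^ d / d\<close>
  of outer points.
\<close>

section \<open>Extended formulations over arbitrary finite index sets\<close>

text \<open>Enumerating \<open>J\<close> and \<open>K\<close> identifies them with the initial
  segments of the naturals that the definition demands, so that later constructions can use sum
  types and options as indices. Nonemptiness of \<open>J\<close> supplies the positive
  dimension.\<close>

lemma has_extended_formulation_indexed:
  fixes p :: "'i \<Rightarrow> 'a::real_vector" and M :: "'k \<Rightarrow> 'i \<Rightarrow> real" and c :: "'k \<Rightarrow> real"
  assumes J: "finite J" "J \<noteq> {}" and K: "finite K"
    and P: "P = {(\<Sum>j\<in>J. w j *\<^sub>R p j) | w. \<forall>k\<in>K. c k + (\<Sum>j\<in>J. w j * M k j) \<ge> 0}"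
  shows "has_extended_formulation P (card K)"
proof -
  obtain e where e: "bij_betw e {..<card J} J"
    using ex_bij_betw_nat_finite[OF J(1)] by (auto simp: atLeast0LessThan)
  obtain g where g: "bij_betw g {..<card K} K"
    using ex_bij_betw_nat_finite[OF K] by (auto simp: atLeast0LessThan)
  define \<phi> where "\<phi> x = (\<Sum>j<card J. x j *\<^sub>R p (e j))" for x :: "nat \<Rightarrow> real"
  define N where "N k x = c (g k) + (\<Sum>j<card J. x j * M (g k) (e j))" for k and x :: "nat \<Rightarrow> real"
  have reindex: "(\<Sum>j\<in>J. f j) = (\<Sum>j<card J. f (e j))" for f :: "'i \<Rightarrow> 'b::comm_monoid_add"
    using sum.reindex_bij_betw[OF e] by metis
  have all_K: "(\<forall>k\<in>K. Q k) \<longleftrightarrow> (\<forall>k<card K. Q (g k))" for Q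
    using bij_betw_imp_surj_on[OF g] by (metis imageE image_eqI lessThan_iff)
  have P': "P = {(\<Sum>j<card J. w (e j) *\<^sub>R p (e j)) | w.
      \<forall>k<card K. c (g k) + (\<Sum>j<card J. w (e j) * M (g k) (e j)) \<ge> 0}"
    unfolding P by (simp only: reindex all_K)
  have "P = \<phi> ` {x \<in> vecs (card J). \<forall>k<card K. N k x \<ge> 0}"
  proof (intro equalityI subsetI)
    fix y assume "y \<in> P"
    then obtain w where y: "y = (\<Sum>j<card J. w (e j) *\<^sub>R p (e j))"
      and w: "\<forall>k<card K. c (g k) + (\<Sum>j<card J. w (e j) * M (g k) (e j)) \<ge> 0"
      unfolding P' by blast
    \<comment> \<open>Membership in \<open>vecs\<close> requires the value \<open>undefined\<close>
      outside \<open>{..<card J}\<close>, hence \<open>restrict\<close>.\<close>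
    define x where "x = restrict (w \<circ> e) {..<card J}"
    have "x \<in> vecs (card J)" by (simp add: x_def vecs_def)
    moreover have "\<forall>k<card K. N k x \<ge> 0" using w by (simp add: N_def x_def)
    moreover have "y = \<phi> x" by (simp add: y \<phi>_def x_def)
    ultimately show "y \<in> \<phi> ` {x \<in> vecs (card J). \<forall>k<card K. N k x \<ge> 0}" by blast
  next
    fix y assume "y \<in> \<phi> ` {x \<in> vecs (card J). \<forall>k<card K. N k x \<ge> 0}"
    then obtain x where x: "y = \<phi> x" "\<forall>k<card K. N k x \<ge> 0" by blast
    \<comment> \<open>Only the values of \<open>w\<close> on \<open>J\<close> enter
      \<open>P'\<close>, so the arbitrary values of \<open>the_inv_into\<close> elsewhere do no
      harm.\<close>
    define w where "w = x \<circ> the_inv_into {..<card J} e"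
    have "w (e j) = x j" if "j < card J" for j
      using that e by (simp add: w_def the_inv_into_f_f bij_betw_def)
    then show "y \<in> P" using x unfolding P' \<phi>_def N_def by (intro CollectI exI[of _ w]) simp
  qed
  moreover have "affine_map (card J) \<phi>"
    unfolding affine_map_def \<phi>_def by (intro exI[of _ 0] exI[of _ "p \<circ> e"]) simp
  moreover have "affine_map (card J) (N k)" for k
    unfolding affine_map_def N_def
    by (intro exI[of _ "c (g k)"] exI[of _ "M (g k) \<circ> e"]) simp
  moreover have "card J \<ge> 1" using J by (simp add: Suc_le_eq card_gt_0_iff)
  ultimately show ?thesis
    unfolding has_extended_formulation_def
    by (intro exI[of _ "card J"] exI[of _ \<phi>] exI[of _ N] conjI allI impI) simp_all
qed

text \<open>A nonnegative variable costs one inequality; an equation is split into two opposite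
  ones, whence the factor 2.\<close>

lemma has_extended_formulation_standard_form:
  fixes p :: "'i \<Rightarrow> 'a::real_vector" and M :: "'k \<Rightarrow> 'i \<Rightarrow> real" and c :: "'k \<Rightarrow> real"
  assumes J: "finite J" "J \<noteq> {}" and K: "finite K"
    and P: "P = {(\<Sum>j\<in>J. w j *\<^sub>R p j) | w.
      (\<forall>j\<in>J. w j \<ge> 0) \<and> (\<forall>k\<in>K. (\<Sum>j\<in>J. w j * M k j) = c k)}"
  shows "has_extended_formulation P (card J + 2 * card K)"
proof -
  \<comment> \<open>\<open>Inl i\<close> indexes the sign constraint on \<open>w i\<close>;
    \<open>Inr (Inl k)\<close> and \<open>Inr (Inr k)\<close> index the lower and the upper half of
    equation \<open>k\<close>.\<close>
  define N where "N k j = (case k of Inl i \<Rightarrow> if j = i then 1 else 0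
      | Inr (Inl k) \<Rightarrow> M k j | Inr (Inr k) \<Rightarrow> - M k j)" for k :: "'i + 'k + 'k" and j
  define b where "b k = (case k of Inl i \<Rightarrow> 0 | Inr (Inl k) \<Rightarrow> - c k | Inr (Inr k) \<Rightarrow> c k)"
    for k :: "'i + 'k + 'k"
  have "(\<forall>j\<in>J. w j \<ge> 0) \<and> (\<forall>k\<in>K. (\<Sum>j\<in>J. w j * M k j) = c k) \<longleftrightarrow>
      (\<forall>k\<in>J <+> K <+> K. b k + (\<Sum>j\<in>J. w j * N k j) \<ge> 0)" for w
  proof -
    have "(\<Sum>j\<in>J. w j * N (Inl i) j) = w i" if "i \<in> J" for i
      using J(1) that by (simp add: N_def if_distrib[of "(*) _"] cong: if_cong)
    moreover have "(\<Sum>j\<in>J. w j * N (Inr (Inl k)) j) = (\<Sum>j\<in>J. w j * M k j)"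
      "(\<Sum>j\<in>J. w j * N (Inr (Inr k)) j) = - (\<Sum>j\<in>J. w j * M k j)" for k
      by (simp_all add: N_def sum_negf)
    ultimately show ?thesis by (fastforce simp: Plus_def ball_Un b_def)
  qed
  then have "P = {(\<Sum>j\<in>J. w j *\<^sub>R p j) | w.
      \<forall>k\<in>J <+> K <+> K. b k + (\<Sum>j\<in>J. w j * N k j) \<ge> 0}"
    unfolding P by simp
  from has_extended_formulation_indexed[OF J _ this] J K show ?thesis
    by (simp add: card_Plus mult_2)
qed

section \<open>Convex hulls of unions of products\<close>

text \<open>Since \<open>a + b\<close> splits into its two parts, a convex combination depends on
  the weights of the pairs only through their marginals on each block of pairs with a common slice
  \<open>Y\<close>. Conversely, two marginals of equal mass on a block are realized by a normalized
  product. For \<open>Y = {}\<close> the balance equation forces weight 0 on the points with empty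
  slice.\<close>

lemma convex_hull_sumset_slices:
  fixes F :: "'a::real_vector \<Rightarrow> 'a set"
  assumes A: "finite A" and B: "finite B" and F: "F ` A \<subseteq> Pow B"
  shows "convex hull {a + b | a b. a \<in> A \<and> b \<in> F a} =
    {(\<Sum>a\<in>A. u a *\<^sub>R a) + (\<Sum>Y\<in>Pow B. \<Sum>y\<in>Y. v Y y *\<^sub>R y) | u v.
      (\<forall>a\<in>A. u a \<ge> 0) \<and> (\<forall>Y\<in>Pow B. \<forall>y\<in>Y. v Y y \<ge> 0) \<and> sum u A = 1 \<and>
      (\<forall>Y\<in>Pow B. sum u {a \<in> A. F a = Y} = sum (v Y) Y)}"
    (is "convex hull ?X = {?f u v | u v. ?feasible u v}")
proof (intro equalityI hull_minimal subsetI)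
  fix x assume "x \<in> ?X"
  then obtain a b where x: "x = a + b" "a \<in> A" "b \<in> F a" by blast
  \<comment> \<open>Point masses: \<open>u\<close> at \<open>a\<close>, and \<open>v\<close> at
    \<open>b\<close> within the block of \<open>F a\<close>.\<close>
  define u :: "'a \<Rightarrow> real" where "u a' = (if a' = a then 1 else 0)" for a'
  define v :: "'a set \<Rightarrow> 'a \<Rightarrow> real" where "v Y y = (if Y = F a then if y = b then 1 else 0 else 0)"
    for Y y
  have FaB: "F a \<subseteq> B" using x F by blast
  have finF: "finite (F a)" using FaB B finite_subset by blast
  have "sum (v Y) Y = (if Y = F a then 1 else 0)" if "Y \<in> Pow B" for Y
    using finF x(3) by (simp add: v_def)
  moreover have "sum u {a \<in> A. F a = Y} = (if Y = F a then 1 else 0)" for Y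
    using A x(2) by (auto simp: u_def)
  moreover have "sum u A = 1" using A x(2) by (simp add: u_def)
  ultimately have "?feasible u v" by (auto simp: u_def v_def)
  moreover have "(\<Sum>a\<in>A. u a *\<^sub>R a) = a"
    using A x(2) by (simp add: u_def if_distrib[of "\<lambda>t. t *\<^sub>R _"] cong: if_cong)
  moreover have "(\<Sum>Y\<in>Pow B. \<Sum>y\<in>Y. v Y y *\<^sub>R y) = b"
  proof -
    have "(\<Sum>y\<in>Y. v Y y *\<^sub>R y) = (if Y = F a then b else 0)" if "Y \<in> Pow B" for Y
      using finF x(3)
      by (simp add: v_def if_distrib[of "\<lambda>t. t *\<^sub>R _"] cong: if_cong)
    then show ?thesis using B FaB by simp
  qed
  ultimately show "x \<in> {?f u v | u v. ?feasible u v}"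
    unfolding x(1) by (intro CollectI exI[of _ u] exI[of _ v]) simp
next
  show "convex {?f u v | u v. ?feasible u v}"
  proof (rule convexI)
    fix x y and s t :: real
    assume "x \<in> {?f u v | u v. ?feasible u v}" "y \<in> {?f u v | u v. ?feasible u v}"
      and st: "0 \<le> s" "0 \<le> t" "s + t = 1"
    then obtain u v u' v' where x: "x = ?f u v" "?feasible u v" and y: "y = ?f u' v'" "?feasible u' v'"
      by blast
    define u'' where "u'' a = s * u a + t * u' a" for a
    define v'' where "v'' Y y = s * v Y y + t * v' Y y" for Y y
    \<comment> \<open>\<open>A'\<close> is left arbitrary to cover both the normalization over
      \<open>A\<close> and the balance equations over the fibres of \<open>F\<close>.\<close>
    have sum_u'': "sum u'' A' = s * sum u A' + t * sum u' A'" for A'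
      by (simp add: u''_def sum.distrib sum_distrib_left)
    moreover have "sum (v'' Y) Y = s * sum (v Y) Y + t * sum (v' Y) Y" for Y
      by (simp add: v''_def sum.distrib sum_distrib_left)
    ultimately have "?feasible u'' v''"
      using x(2) y(2) st by (auto simp: u''_def v''_def)
    moreover have "s *\<^sub>R x + t *\<^sub>R y = ?f u'' v''"
      unfolding x y u''_def v''_def
      by (simp add: scaleR_add_left scaleR_add_right sum.distrib scaleR_sum_right)
    ultimately show "s *\<^sub>R x + t *\<^sub>R y \<in> {?f u v | u v. ?feasible u v}" by blast
  qed
next
  fix x assume "x \<in> {?f u v | u v. ?feasible u v}"
  then obtain u v where x: "x = ?f u v" and u0: "\<And>a. a \<in> A \<Longrightarrow> u a \<ge> 0"
    and v0: "\<And>Y y. Y \<subseteq> B \<Longrightarrow> y \<in> Y \<Longrightarrow> v Y y \<ge> 0" and u1: "sum u A = 1"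
    and uv: "\<And>Y. Y \<subseteq> B \<Longrightarrow> sum u {a \<in> A. F a = Y} = sum (v Y) Y"
    by blast
  have FB: "F a \<subseteq> B" if "a \<in> A" for a using F that by blast
  have fin: "finite Y" if "Y \<subseteq> B" for Y using that B finite_subset by blast
  define s where "s Y = sum (v Y) Y" for Y
  have s0: "s Y \<ge> 0" if "Y \<subseteq> B" for Y unfolding s_def using v0 that by (auto intro: sum_nonneg)
  text \<open>
    The product measure on each \<open>F -` {Y} \<times> Y\<close>. If \<open>s Y = 0\<close> then all weights involved vanish, so
    that division by zero does no harm.
  \<close>
  define w where "w a y = u a * v (F a) y / s (F a)" for a y
  have w0: "w a y \<ge> 0" if "a \<in> A" "y \<in> F a" for a y
    unfolding w_def using u0 v0 s0 FB that by simp
  \<comment> \<open>\<open>w_row\<close> and \<open>w_col\<close> identify the marginals of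
    \<open>w\<close> as \<open>u\<close> and \<open>v\<close>.\<close>
  have w_row: "(\<Sum>y\<in>F a. w a y) = u a" if a: "a \<in> A" for a
  proof (cases "s (F a) = 0")
    case True
    then have "sum u {a' \<in> A. F a' = F a} = 0" using uv FB a by (simp add: s_def)
    then have "u a = 0" using sum_nonneg_eq_0_iff[of "{a' \<in> A. F a' = F a}" u] A u0 a by auto
    then show ?thesis by (simp add: w_def)
  next
    case False
    have "(\<Sum>y\<in>F a. w a y) = u a * s (F a) / s (F a)"
      by (simp add: w_def s_def sum_distrib_left sum_divide_distrib)
    with False show ?thesis by simp
  qed
  have w_col: "(\<Sum>a | a \<in> A \<and> F a = Y. w a y) = v Y y" if Y: "Y \<subseteq> B" "y \<in> Y" for Y y
  proof (cases "s Y = 0")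
    case True
    then have "v Y y = 0"
      using sum_nonneg_eq_0_iff[of Y "v Y"] fin v0 Y by (auto simp: s_def)
    then show ?thesis using Y by (simp add: w_def)
  next
    case False
    have "(\<Sum>a | a \<in> A \<and> F a = Y. w a y) = (\<Sum>a | a \<in> A \<and> F a = Y. u a * v Y y / s Y)"
      by (rule sum.cong) (auto simp: w_def)
    also have "\<dots> = sum u {a \<in> A. F a = Y} * v Y y / s Y"
      by (simp add: sum_distrib_right sum_divide_distrib)
    also have "\<dots> = v Y y" using False uv[OF Y(1)] by (simp add: s_def)
    finally show ?thesis .
  qed
  \<comment> \<open>The range of \<open>y\<close> depends on \<open>a\<close>. Grouping by the slice
    makes it constant in each block, so that the sums can be swapped and \<open>w_col\<close>
    applies.\<close>
  have "(\<Sum>a\<in>A. \<Sum>y\<in>F a. w a y *\<^sub>R y) = (\<Sum>Y\<in>Pow B. \<Sum>a | a \<in> A \<and> F a = Y. \<Sum>y\<in>F a. w a y *\<^sub>R y)"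
    by (rule sum.group[OF A _ F, symmetric]) (simp add: B)
  also have "\<dots> = (\<Sum>Y\<in>Pow B. \<Sum>a | a \<in> A \<and> F a = Y. \<Sum>y\<in>Y. w a y *\<^sub>R y)"
    by (intro sum.cong refl) simp_all
  also have "\<dots> = (\<Sum>Y\<in>Pow B. \<Sum>y\<in>Y. \<Sum>a | a \<in> A \<and> F a = Y. w a y *\<^sub>R y)"
    by (rule sum.cong[OF refl sum.swap])
  also have "\<dots> = (\<Sum>Y\<in>Pow B. \<Sum>y\<in>Y. v Y y *\<^sub>R y)"
    by (intro sum.cong refl) (simp add: w_col flip: scaleR_sum_left)
  finally have inner: "(\<Sum>a\<in>A. \<Sum>y\<in>F a. w a y *\<^sub>R y) = (\<Sum>Y\<in>Pow B. \<Sum>y\<in>Y. v Y y *\<^sub>R y)" .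
  have outer: "(\<Sum>a\<in>A. \<Sum>y\<in>F a. w a y *\<^sub>R a) = (\<Sum>a\<in>A. u a *\<^sub>R a)"
    by (simp add: w_row flip: scaleR_sum_left)
  have finF: "\<forall>a\<in>A. finite (F a)" using FB fin by blast
  have "x = (\<Sum>a\<in>A. \<Sum>y\<in>F a. w a y *\<^sub>R (a + y))"
    by (simp add: x scaleR_add_right sum.distrib inner outer)
  also have "\<dots> = (\<Sum>(a, y)\<in>Sigma A F. w a y *\<^sub>R (a + y))"
    by (rule sum.Sigma[OF A finF])
  finally have x': "x = (\<Sum>z\<in>Sigma A F. w (fst z) (snd z) *\<^sub>R (fst z + snd z))"
    by (simp add: case_prod_beta)
  have "(\<Sum>z\<in>Sigma A F. w (fst z) (snd z)) = 1"
    using sum.Sigma[OF A finF, of w] by (simp add: w_row u1 case_prod_beta)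
  moreover have "finite (Sigma A F)" using A finF by auto
  moreover have "w (fst z) (snd z) \<ge> 0" if "z \<in> Sigma A F" for z
    using that w0 by auto
  moreover have "fst z + snd z \<in> convex hull ?X" if "z \<in> Sigma A F" for z
    using that by (intro hull_inc CollectI exI[of _ "fst z"] exI[of _ "snd z"]) auto
  ultimately show "x \<in> convex hull ?X"
    unfolding x' by (intro convex_sum convex_convex_hull)
qed

text \<open>The variables are the weights on \<open>A\<close> and on each \<open>Y\<close>. The
  equations are one balance per subset of \<open>B\<close> and one normalization, which gives the
  \<open>2 ^ card B + 1\<close>.\<close>

lemma has_extended_formulation_sumset_slices:
  fixes F :: "'a::real_vector \<Rightarrow> 'a set"
  assumes A: "finite A" "A \<noteq> {}" and B: "finite B" and F: "F ` A \<subseteq> Pow B"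
  shows "has_extended_formulation (convex hull {a + b | a b. a \<in> A \<and> b \<in> F a})
    (card A + (\<Sum>Y\<in>Pow B. card Y) + 2 * (2 ^ card B + 1))"
proof -
  define J where "J = A <+> Sigma (Pow B) (\<lambda>Y. Y)"
  \<comment> \<open>\<open>None\<close> indexes the normalization, \<open>Some Z\<close> the mass
    balance for the slice \<open>Z\<close>.\<close>
  define K where "K = insert None (Some ` Pow B)"
  define p where "p j = (case j of Inl a \<Rightarrow> a | Inr (Y, y) \<Rightarrow> y)" for j :: "'a + 'a set \<times> 'a"
  define M :: "'a set option \<Rightarrow> 'a + 'a set \<times> 'a \<Rightarrow> real" where
    "M k j = (case k of
        None \<Rightarrow> (case j of Inl a \<Rightarrow> 1 | Inr _ \<Rightarrow> 0)
      | Some Z \<Rightarrow> (case j of Inl a \<Rightarrow> if F a = Z then 1 else 0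
          | Inr (Y, y) \<Rightarrow> if Y = Z then -1 else 0))" for k j
  define c :: "'a set option \<Rightarrow> real" where "c k = (case k of None \<Rightarrow> 1 | Some Z \<Rightarrow> 0)" for k
  have fin: "\<forall>Y\<in>Pow B. finite Y" using B finite_subset by blast
  have finS: "finite (Sigma (Pow B) (\<lambda>Y. Y))" using B fin by auto
  have sum_J: "(\<Sum>j\<in>J. h j) = (\<Sum>a\<in>A. h (Inl a)) + (\<Sum>Y\<in>Pow B. \<Sum>y\<in>Y. h (Inr (Y, y)))"
    for h :: "'a + 'a set \<times> 'a \<Rightarrow> 'b::comm_monoid_add"
    unfolding J_def using sum.Plus[OF A(1) finS, of h]
      sum.Sigma[of "Pow B" "\<lambda>Y. Y" "\<lambda>Y y. h (Inr (Y, y))"] B fin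
    by (simp add: case_prod_beta)
  have val: "(\<Sum>j\<in>J. w j *\<^sub>R p j) =
      (\<Sum>a\<in>A. w (Inl a) *\<^sub>R a) + (\<Sum>Y\<in>Pow B. \<Sum>y\<in>Y. w (Inr (Y, y)) *\<^sub>R y)" for w
    by (simp add: sum_J p_def)
  have M_None: "(\<Sum>j\<in>J. w j * M None j) = (\<Sum>a\<in>A. w (Inl a))" for w
    by (simp add: sum_J M_def)
  have M_Some: "(\<Sum>j\<in>J. w j * M (Some Z) j) =
      (\<Sum>a | a \<in> A \<and> F a = Z. w (Inl a)) - (\<Sum>y\<in>Z. w (Inr (Z, y)))" if "Z \<in> Pow B" for w Z
  proof -
    have "(\<Sum>a\<in>A. w (Inl a) * M (Some Z) (Inl a)) = (\<Sum>a | a \<in> A \<and> F a = Z. w (Inl a))"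
      unfolding sum.inter_filter[OF A(1)] by (rule sum.cong) (auto simp: M_def)
    moreover have "(\<Sum>y\<in>Y. w (Inr (Y, y)) * M (Some Z) (Inr (Y, y))) =
        (if Y = Z then - (\<Sum>y\<in>Z. w (Inr (Z, y))) else 0)" for Y
      by (simp add: M_def sum_negf)
    ultimately show ?thesis using B that by (simp add: sum_J)
  qed
  have feasible: "(\<forall>j\<in>J. w j \<ge> 0) \<and> (\<forall>k\<in>K. (\<Sum>j\<in>J. w j * M k j) = c k) \<longleftrightarrow>
      (\<forall>a\<in>A. w (Inl a) \<ge> 0) \<and> (\<forall>Y\<in>Pow B. \<forall>y\<in>Y. w (Inr (Y, y)) \<ge> 0) \<and>
      (\<Sum>a\<in>A. w (Inl a)) = 1 \<and>
      (\<forall>Y\<in>Pow B. (\<Sum>a | a \<in> A \<and> F a = Y. w (Inl a)) = (\<Sum>y\<in>Y. w (Inr (Y, y))))" for w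
  proof -
    have "(\<forall>k\<in>K. (\<Sum>j\<in>J. w j * M k j) = c k) \<longleftrightarrow> (\<Sum>a\<in>A. w (Inl a)) = 1 \<and>
      (\<forall>Y\<in>Pow B. (\<Sum>a | a \<in> A \<and> F a = Y. w (Inl a)) = (\<Sum>y\<in>Y. w (Inr (Y, y))))"
      unfolding K_def by (simp add: M_None M_Some c_def)
    moreover have "(\<forall>j\<in>J. w j \<ge> 0) \<longleftrightarrow>
      (\<forall>a\<in>A. w (Inl a) \<ge> 0) \<and> (\<forall>Y\<in>Pow B. \<forall>y\<in>Y. w (Inr (Y, y)) \<ge> 0)"
      by (auto simp: J_def)
    ultimately show ?thesis by blast
  qed
  have "convex hull {a + b | a b. a \<in> A \<and> b \<in> F a} = {(\<Sum>j\<in>J. w j *\<^sub>R p j) | w.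
      (\<forall>j\<in>J. w j \<ge> 0) \<and> (\<forall>k\<in>K. (\<Sum>j\<in>J. w j * M k j) = c k)}" (is "_ = ?R")
    unfolding convex_hull_sumset_slices[OF A(1) B F] feasible val
  proof (intro equalityI subsetI, goal_cases)
    case (1 x)
    then obtain u v where "x = (\<Sum>a\<in>A. u a *\<^sub>R a) + (\<Sum>Y\<in>Pow B. \<Sum>y\<in>Y. v Y y *\<^sub>R y)"
      "\<forall>a\<in>A. u a \<ge> 0" "\<forall>Y\<in>Pow B. \<forall>y\<in>Y. v Y y \<ge> 0" "sum u A = 1"
      "\<forall>Y\<in>Pow B. sum u {a \<in> A. F a = Y} = sum (v Y) Y" by blast
    then show ?case
      by (intro CollectI exI[of _ "case_sum u (\<lambda>(Y, y). v Y y)"]) simp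
  next
    case (2 x)
    then obtain w where "x = (\<Sum>a\<in>A. w (Inl a) *\<^sub>R a) + (\<Sum>Y\<in>Pow B. \<Sum>y\<in>Y. w (Inr (Y, y)) *\<^sub>R y)"
      "(\<forall>a\<in>A. w (Inl a) \<ge> 0) \<and> (\<forall>Y\<in>Pow B. \<forall>y\<in>Y. w (Inr (Y, y)) \<ge> 0) \<and>
      (\<Sum>a\<in>A. w (Inl a)) = 1 \<and>
      (\<forall>Y\<in>Pow B. (\<Sum>a | a \<in> A \<and> F a = Y. w (Inl a)) = (\<Sum>y\<in>Y. w (Inr (Y, y))))" by blast
    then show ?case
      by (intro CollectI exI[of _ "\<lambda>a. w (Inl a)"] exI[of _ "\<lambda>Y y. w (Inr (Y, y))"]) simp
  qed
  moreover have "finite J" "J \<noteq> {}" "finite K" using A B finS by (auto simp: J_def K_def)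
  ultimately have "has_extended_formulation (convex hull {a + b | a b. a \<in> A \<and> b \<in> F a})
      (card J + 2 * card K)"
    by (intro has_extended_formulation_standard_form)
  moreover have "card J = card A + (\<Sum>Y\<in>Pow B. card Y)"
    unfolding J_def using A(1) B fin finS by (simp add: card_Plus)
  moreover have "card K = 2 ^ card B + 1"
    unfolding K_def using B by (simp add: card_insert_if card_image card_Pow)
  ultimately show ?thesis by simp
qed

section \<open>From sumsets to 0/1-polytopes\<close>

lemma xc_le: "has_extended_formulation P l \<Longrightarrow> xc P \<le> l"
  unfolding xc_def by (auto intro: Least_le)

text \<open>Taking for \<open>F a\<close> the slice of \<open>X\<close> over \<open>a\<close> brings
  any \<open>X\<close> inside the sumset into the required form. Bounding each \<open>card Y\<close>
  by \<open>card B\<close> loses only a factor of 2 in the sum over all subsets.\<close>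

lemma xc_convex_hull_le:
  fixes X :: "'a::real_vector set"
  assumes A: "finite A" "A \<noteq> {}" and B: "finite B"
    and X: "X \<subseteq> {a + b | a b. a \<in> A \<and> b \<in> B}"
  shows "xc (convex hull X) \<le> card A + 2 ^ card B * (card B + 2) + 2"
proof -
  define F where "F a = {b \<in> B. a + b \<in> X}" for a
  have X_eq: "X = {a + b | a b. a \<in> A \<and> b \<in> F a}" using X unfolding F_def by blast
  have "F ` A \<subseteq> Pow B" by (auto simp: F_def)
  then have "xc (convex hull X) \<le> card A + (\<Sum>Y\<in>Pow B. card Y) + 2 * (2 ^ card B + 1)"
    unfolding X_eq by (intro xc_le has_extended_formulation_sumset_slices A B)
  also have "(\<Sum>Y\<in>Pow B. card Y) \<le> 2 ^ card B * card B"
    using sum_bounded_above[of "Pow B" card "card B"] B by (simp add: card_mono card_Pow)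
  finally show ?thesis by (simp add: algebra_simps)
qed

text \<open>A 0/1-vector vanishing outside \<open>I\<close> is the indicator vector of a subset of
  \<open>I\<close>.\<close>

lemma zero_one_points_supported:
  fixes I :: "'d::finite set"
  defines "C \<equiv> {x :: real ^ 'd. x \<in> zero_one_points \<and> (\<forall>i. i \<notin> I \<longrightarrow> x $ i = 0)}"
  shows "finite C" and "card C \<le> 2 ^ card I"
proof -
  have C: "C \<subseteq> (\<lambda>S. \<chi> i. if i \<in> S then 1 else 0) ` Pow I"
  proof
    fix x assume x: "x \<in> C"
    then have "x = (\<chi> i. if i \<in> {i. x $ i = 1} then 1 else 0)"
      by (auto simp: C_def zero_one_points_def vec_eq_iff)
    moreover have "{i. x $ i = 1} \<in> Pow I" using x by (force simp: C_def)
    ultimately show "x \<in> (\<lambda>S. \<chi> i. if i \<in> S then 1 else 0) ` Pow I" by blast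
  qed
  show "finite C" by (rule finite_subset[OF C]) simp
  have "card C \<le> card (Pow I)" by (rule surj_card_le[OF _ C]) simp
  then show "card C \<le> 2 ^ card I" by (simp add: card_Pow)
qed

text \<open>With \<open>I\<close> as the set of inner coordinates, a 0/1-vector is the sum of its
  parts supported on the complement of \<open>I\<close> and on \<open>I\<close>; these parts play
  the roles of \<open>A\<close> and \<open>B\<close>.\<close>

lemma xc_zero_one_polytope_le:
  fixes P :: "(real ^ 'd) set"
  assumes P: "P \<in> zero_one_polytopes" and m: "m \<le> CARD('d)"
  shows "xc P \<le> 2 ^ (CARD('d) - m) + 2 ^ 2 ^ m * (2 ^ m + 2) + 2"
proof -
  obtain X where X: "X \<subseteq> zero_one_points" "P = convex hull X"
    using P unfolding zero_one_polytopes_def by blast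
  obtain I :: "'d set" where I: "card I = m"
    using m obtain_subset_with_card_n by blast
  define C where "C I = {x :: real ^ 'd. x \<in> zero_one_points \<and> (\<forall>i. i \<notin> I \<longrightarrow> x $ i = 0)}" for I
  note C = zero_one_points_supported[where 'd = 'd, folded C_def]
  \<comment> \<open>The zero vector makes the outer set nonempty, even if \<open>X\<close> is
    empty.\<close>
  have "0 \<in> C (- I)" by (simp add: C_def zero_one_points_def)
  moreover have "X \<subseteq> {a + b | a b. a \<in> C (- I) \<and> b \<in> C I}"
  proof
    fix x assume "x \<in> X"
    then have "x \<in> zero_one_points" using X by blast
    then have "(\<chi> i. if i \<in> I then 0 else x $ i) \<in> C (- I)" "(\<chi> i. if i \<in> I then x $ i else 0) \<in> C I"
      by (auto simp: C_def zero_one_points_def)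
    moreover have "x = (\<chi> i. if i \<in> I then 0 else x $ i) + (\<chi> i. if i \<in> I then x $ i else 0)"
      by (simp add: vec_eq_iff)
    ultimately show "x \<in> {a + b | a b. a \<in> C (- I) \<and> b \<in> C I}" by blast
  qed
  ultimately have "xc P \<le> card (C (- I)) + 2 ^ card (C I) * (card (C I) + 2) + 2"
    unfolding X by (intro xc_convex_hull_le C) auto
  also have "\<dots> \<le> 2 ^ card (- I) + 2 ^ 2 ^ card I * (2 ^ card I + 2) + 2"
    by (intro add_mono mult_mono power_increasing C) auto
  also have "card (- I) = CARD('d) - m" by (simp add: Compl_eq_Diff_UNIV card_Diff_subset I)
  finally show ?thesis by (simp add: I)
qed

section \<open>Numerical estimates and conclusion\<close>

text \<open>Equality holds at \<open>h = 2\<close>. From then on \<open>4 \<le> h * h\<close>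
  ensures that the left side at most doubles in each step.\<close>

lemma quadratic_le_power2: "h \<ge> 2 \<Longrightarrow> 2 * h * (h + 2) \<le> 4 * (2::nat) ^ h"
proof (induction h rule: dec_induct)
  case (step h)
  have "2 * Suc h * (Suc h + 2) \<le> 2 * (2 * h * (h + 2))"
    using step.hyps mult_le_mono[of 2 h 2 h] by (simp add: algebra_simps)
  with step.IH show ?case by simp
qed simp

text \<open>The 5 is 4 + 1: for \<open>d = 2 * h\<close> the product term contributes at most
  \<open>4 * 2 ^ (2 * h)\<close>, and the summand 2 contributes
  \<open>4 * h \<le> 2 ^ (2 * h)\<close>.\<close>

lemma slice_count_le:
  assumes d: "d \<ge> 4"
  shows "d * (2 ^ (d div 2) * (d div 2 + 2) + 2) \<le> 5 * (2::nat) ^ d"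
proof -
  define h where "h = d div 2"
  have h: "h \<ge> 2" using d by (simp add: h_def)
  have sq: "2 ^ h * 2 ^ h = (2::nat) ^ (2 * h)" by (simp add: mult_2 power_add)
  have "4 * h \<le> 2 * h * (h + 2)" by simp
  also have "\<dots> \<le> 4 * 2 ^ h" by (rule quadratic_le_power2[OF h])
  also have "(4::nat) * 2 ^ h \<le> 2 ^ h * 2 ^ h"
    using power_increasing[OF h, of "2::nat"] by (intro mult_mono) auto
  finally have "4 * h \<le> 2 ^ (2 * h)" unfolding sq .
  moreover have "2 ^ h * (2 * h * (h + 2)) \<le> 2 ^ h * (4 * 2 ^ h)"
    using quadratic_le_power2[OF h] by (intro mult_left_mono) auto
  ultimately have even: "2 * h * (2 ^ h * (h + 2) + 2) \<le> 5 * 2 ^ (2 * h)"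
    unfolding sq[symmetric] by (simp add: algebra_simps)
  show ?thesis
  proof (cases "even d")
    case True
    then have "d = 2 * h" by (simp add: h_def)
    with even show ?thesis by simp
  next
    case False
    then have d': "d = 2 * h + 1" by (simp add: h_def)
    \<comment> \<open>The odd case costs a factor of at most 2 on the left, as
      \<open>2 * h + 1 \<le> 2 * (2 * h)\<close>, and gains exactly 2 on the right.\<close>
    then have "d * (2 ^ h * (h + 2) + 2) \<le> 2 * (2 * h * (2 ^ h * (h + 2) + 2))"
      using h unfolding mult.assoc[symmetric] by (intro mult_right_mono) auto
    also have "\<dots> \<le> 5 * 2 ^ d" using even d' by simp
    finally show ?thesis by (simp add: h_def)
  qed
qed

theorem theorem10:
  fixes P :: "(real ^ 'd) set"
  assumes "CARD('d) \<ge> 4"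
    and "P \<in> zero_one_polytopes"
  shows "real (xc P) \<le> 9 * (2 ^ CARD('d) / real CARD('d))"
proof -
  define d where "d = CARD('d)"
  have d: "d \<ge> 4" using assms by (simp add: d_def)
  \<comment> \<open>The lower estimate keeps the number of slices at most
    \<open>2 ^ (d div 2)\<close>; the upper one gives \<open>d < 4 * 2 ^ m\<close>, which pays for
    the outer points.\<close>
  obtain m where m: "2 ^ m \<le> d div 2" "d div 2 < 2 ^ (m + 1)"
    using ex_power_ivl1[of 2 "d div 2"] d by (auto simp: Suc_le_eq)
  have "m < 2 ^ m" by simp
  then have md: "m \<le> d" using m(1) by linarith
  have "d * xc P \<le> d * (2 ^ (d - m) + 2 ^ 2 ^ m * (2 ^ m + 2) + 2)"
    using xc_zero_one_polytope_le[OF assms(2), of m] md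
    by (intro mult_left_mono) (simp_all add: d_def)
  also have "\<dots> \<le> d * (2 ^ (d - m) + 2 ^ (d div 2) * (d div 2 + 2) + 2)"
    using m(1) by (intro mult_left_mono add_mono mult_mono power_increasing) auto
  also have "\<dots> = d * 2 ^ (d - m) + d * (2 ^ (d div 2) * (d div 2 + 2) + 2)"
    by (simp add: algebra_simps)
  \<comment> \<open>The final 9 is 4 from the outer points plus 5 from all terms involving slices
    and equations.\<close>
  also have "\<dots> \<le> 4 * 2 ^ m * 2 ^ (d - m) + 5 * 2 ^ d"
    using m(2) by (intro add_mono mult_right_mono slice_count_le d) auto
  also have "\<dots> = 9 * 2 ^ d" using md by (simp flip: power_add)
  finally have "real (d * xc P) \<le> real (9 * 2 ^ d)" by (rule of_nat_mono)
  then show ?thesis using d by (simp add: d_def field_simps)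
qed

end
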